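(* Let $(p_i)_{i\ge 3}$ and $(q_i)_{i\ge 3}$ be two sequences of arbitrary positive integers, and let $\mathrm{G}_k(n)$ be the generalized Frame–Stewart numbers defined below. Then for every integer $k\ge 3$ and every positive integer $n$, $$\mathrm{G}_k(n) = q\cdot\sum_{j=1}^{n}u^k_j,$$ where $q=\prod_{i=3}^{k}q_i$ and $u^k_j$ is the $j$th term of the sequence $(u^k_j)_{j\ge1}$ of integers $\prod_{i=3}^{k}p_i^{\alpha_i}$ (with $\alpha_i\ge 0$ for all $i$) lined in increasing order.
   Context: The generalized Frame–Stewart numbers are defined by $\mathrm{G}_k(0)=0$ for $k\ge 3$; $\mathrm{G}_3(n)=p_3\cdot\mathrm{G}_3(n-1)+q_3$ for $n\ge1$; and for $k\ge 4$, $n\ge 1$, $$\mathrm{G}_k(n)=\min_{1\le t\le n}\bigl\{p_k\cdot\mathrm{G}_k(n-t)+q_k\cdot\mathrm{G}_{k-1}(t)\bigr\}.$$ The sequence $(u^k_j)_{j\ge1}$ is the list, in nondecreasing order and counted with multiplicity over the exponent tuples $(\alpha_3,\dots,\alpha_k)\in\mathbb{Z}_{\ge0}^{k-2}$, of the numbers $\prod_{i=3}^k p_i^{\alpha_i}$ (e.g. for $(p_3,p_4)=(2,2)$ it begins $1,2,2,4,4,4,8,\dots$; for $(p_3,p_4)=(2,3)$ it begins $1,2,3,4,6,8,9,\dots$). By convention, if $p_{i_0}=1$ for some $3\le i_0\le k$, then $(u^k_j)_{j\ge1}$ is the constant sequence of $1$'s. *)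

theory Defs
  imports Main "HOL-Library.FuncSet"
begin

function frame_stewart :: "(nat \<Rightarrow> nat) \<Rightarrow> (nat \<Rightarrow> nat) \<Rightarrow> nat \<Rightarrow> nat \<Rightarrow> nat" where
  "frame_stewart p q k n =
     (if n = 0 \<or> k < 3 then 0
      else if k = 3 then p 3 * frame_stewart p q 3 (n - 1) + q 3
      else Min ((\<lambda>t. p k * frame_stewart p q k (n - t) + q k * frame_stewart p q (k - 1) t) ` {1..n}))"
  by pat_completeness auto
termination
  by (relation "measures [\<lambda>(p, q, k, n). k, \<lambda>(p, q, k, n). n]")
    auto

declare frame_stewart.simps [simp del]

text \<open>The recursion is meaningful for \<open>k \<ge> 3\<close> only; for \<open>k < 3\<close> the value \<open>0\<close> is a dummy.\<close>

lemma frame_stewart_0: "frame_stewart p q k 0 = 0"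
  by (subst frame_stewart.simps) simp

lemma frame_stewart_3:
  "n \<ge> 1 \<Longrightarrow> frame_stewart p q 3 n = p 3 * frame_stewart p q 3 (n - 1) + q 3"
  by (subst frame_stewart.simps) simp

lemma frame_stewart_rec:
  "k \<ge> 4 \<Longrightarrow> n \<ge> 1 \<Longrightarrow> frame_stewart p q k n =
     Min {p k * frame_stewart p q k (n - t) + q k * frame_stewart p q (k - 1) t | t. 1 \<le> t \<and> t \<le> n}"
  by (subst frame_stewart.simps) (auto intro!: arg_cong[where f = Min])

definition exponent_tuples :: "nat \<Rightarrow> (nat \<Rightarrow> nat) set" where
  "exponent_tuples k = ({3..k} \<rightarrow>\<^sub>E UNIV)"

definition power_product :: "(nat \<Rightarrow> nat) \<Rightarrow> nat \<Rightarrow> (nat \<Rightarrow> nat) \<Rightarrow> nat" where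
  "power_product p k \<alpha> = (\<Prod>i=3..k. p i ^ \<alpha> i)"

text \<open>
  Listing the power products with multiplicity means listing every exponent tuple exactly
  once, indexed from 1.
\<close>
definition sorted_listing :: "(nat \<Rightarrow> nat) \<Rightarrow> nat \<Rightarrow> (nat \<Rightarrow> nat \<Rightarrow> nat) \<Rightarrow> bool" where
  "sorted_listing p k e \<longleftrightarrow>
     bij_betw e {1..} (exponent_tuples k) \<and> mono_on {1..} (\<lambda>j. power_product p k (e j))"

text \<open>
  The listing itself need not be unique (ties may be broken arbitrarily), but its \<open>j\<close>-th value
  is; if all bases are at least 2, a listing exists (lemma \<open>ex1_sorted_listing_value\<close>).
\<close>
definition useq :: "(nat \<Rightarrow> nat) \<Rightarrow> nat \<Rightarrow> nat \<Rightarrow> nat" where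
  "useq p k j =
     (if \<exists>i\<in>{3..k}. p i = 1 then 1
      else (THE x. \<exists>e. sorted_listing p k e \<and> x = power_product p k (e j)))"

lemma finite_power_product_le:
  assumes "\<And>i. i \<in> {3..k} \<Longrightarrow> p i \<ge> 2"
  shows "finite {\<alpha> \<in> exponent_tuples k. power_product p k \<alpha> \<le> m}"
proof (rule finite_subset)
  show "{\<alpha> \<in> exponent_tuples k. power_product p k \<alpha> \<le> m} \<subseteq> ({3..k} \<rightarrow>\<^sub>E {..m})"
  proof clarify
    fix \<alpha> assume \<alpha>: "\<alpha> \<in> exponent_tuples k" and le: "power_product p k \<alpha> \<le> m"
    have "\<alpha> i \<le> m" if i: "i \<in> {3..k}" for i
    proof -
      have "\<alpha> i < 2 ^ \<alpha> i" by (rule less_exp)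
      also have "\<dots> \<le> p i ^ \<alpha> i" using assms[OF i] by (rule power_mono) simp
      also have "\<dots> \<le> power_product p k \<alpha>"
        unfolding power_product_def
      proof (rule dvd_imp_le)
        show "p i ^ \<alpha> i dvd (\<Prod>i=3..k. p i ^ \<alpha> i)" using i by (intro dvd_prodI) auto
        show "0 < (\<Prod>i=3..k. p i ^ \<alpha> i)"
          using assms by (intro prod_pos) (metis neq0_conv not_numeral_le_zero power_eq_0_iff)
      qed
      finally show ?thesis using le by simp
    qed
    then show "\<alpha> \<in> ({3..k} \<rightarrow>\<^sub>E {..m})"
      using \<alpha> by (auto simp: exponent_tuples_def PiE_iff)
  qed
qed (simp add: finite_PiE)

lemma infinite_exponent_tuples:
  assumes "k \<ge> 3"
  shows "infinite (exponent_tuples k)"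
proof -
  have "inj (\<lambda>a::nat. \<lambda>i\<in>{3..k}. a)"
    using assms by (auto intro!: injI dest!: fun_cong[of _ _ 3])
  moreover have "range (\<lambda>a::nat. \<lambda>i\<in>{3..k}. a) \<subseteq> exponent_tuples k"
    by (auto simp: exponent_tuples_def)
  ultimately show ?thesis
    by (meson finite_imageD finite_subset infinite_UNIV_nat)
qed

lemma ex_sorted_listing:
  assumes p: "\<And>i. i \<in> {3..k} \<Longrightarrow> p i \<ge> 2" and k: "k \<ge> 3"
  shows "\<exists>e. sorted_listing p k e"
proof -
  define A where "A = exponent_tuples k"
  define f where "f = power_product p k"
  have infA: "infinite A" unfolding A_def using k by (rule infinite_exponent_tuples)
  have fin: "finite {a \<in> A. f a \<le> m}" for m
    unfolding A_def f_def by (rule finite_power_product_le) (rule p)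
  define P where "P S a \<longleftrightarrow> a \<in> A - S \<and> (\<forall>b \<in> A - S. f a \<le> f b)" for S a
  have ex: "\<exists>a. P S a" if "finite S" for S
  proof -
    have "A - S \<noteq> {}" using infA that by (metis Diff_eq_empty_iff finite_subset)
    then show ?thesis
      unfolding P_def using ex_has_least_nat[of "\<lambda>a. a \<in> A - S" _ f] by blast
  qed
  define l where "l = rec_nat {} (\<lambda>_ S. insert (SOME a. P S a) S)"
  define e where "e n = (SOME a. P (l (n - 1)) a)" for n
  have l0: "l 0 = {}" and lS: "l (Suc n) = insert (e (Suc n)) (l n)" for n
    by (simp_all add: l_def e_def)
  have l: "l n = e ` {1..n}" for n
    by (induction n) (auto simp: l0 lS atLeastAtMostSuc_conv)
  have Pe: "P (e ` {1..<n}) (e n)" if "n \<ge> 1" for n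
  proof -
    have "{1..<n} = {1..n - 1}" using that by auto
    then have eq: "e ` {1..<n} = l (n - 1)" by (simp only: l)
    have "finite (l (n - 1))" by (simp only: l finite_imageI finite_atLeastAtMost)
    then show ?thesis
      unfolding eq e_def[of n] by (rule someI_ex[OF ex])
  qed
  have inj: "e i \<noteq> e j" if "1 \<le> i" "i < j" for i j
  proof -
    have "e j \<notin> e ` {1..<j}" using Pe[of j] that by (simp add: P_def)
    moreover have "e i \<in> e ` {1..<j}" using that by simp
    ultimately show ?thesis by metis
  qed
  have inA: "e i \<in> A" if "1 \<le> i" for i
    using Pe[OF that] by (simp add: P_def)
  have mono: "f (e i) \<le> f (e j)" if "1 \<le> i" "i \<le> j" for i j
  proof -
    have "e j \<notin> e ` {1..<i}"
    proof
      assume "e j \<in> e ` {1..<i}"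
      then obtain i' where i': "e j = e i'" "1 \<le> i'" "i' < i" by auto
      show False using inj[of i' j] i' that by simp
    qed
    then show ?thesis using Pe[of i] inA[of j] that by (simp add: P_def)
  qed
  have inj_on: "inj_on e {1..}"
  proof (rule inj_onI)
    fix i j :: nat assume ij: "i \<in> {1..}" "j \<in> {1..}" "e i = e j"
    show "i = j"
      using inj[of i j] inj[of j i] ij by (cases i j rule: linorder_cases) simp_all
  qed
  have "a \<in> e ` {1..}" if "a \<in> A" for a
  proof (rule ccontr)
    assume a: "a \<notin> e ` {1..}"
    have "f (e n) \<le> f a" if "n \<ge> 1" for n
    proof -
      have "a \<in> A - e ` {1..<n}" using a \<open>a \<in> A\<close> by auto
      then show ?thesis using Pe[OF that] unfolding P_def by blast
    qed
    then have "e ` {1..} \<subseteq> {b \<in> A. f b \<le> f a}" using inA by auto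
    then have "finite (e ` {1..})" by (rule finite_subset) (rule fin)
    then have "finite {1::nat..}" using inj_on by (rule finite_imageD)
    then show False using infinite_Ici by blast
  qed
  moreover have "e ` {1..} \<subseteq> A" using inA by auto
  ultimately have "bij_betw e {1..} A"
    using inj_on unfolding bij_betw_def by blast
  moreover have "mono_on {1..} (\<lambda>j. f (e j))"
    by (rule mono_onI) (simp add: mono)
  ultimately show ?thesis
    unfolding sorted_listing_def A_def f_def by blast
qed

lemma sorted_listing_value_le:
  assumes e: "sorted_listing p k e" and e': "sorted_listing p k e'" and j: "j \<ge> 1"
  shows "power_product p k (e' j) \<le> power_product p k (e j)"
proof (rule ccontr)
  let ?f = "power_product p k"
  assume less: "\<not> ?f (e' j) \<le> ?f (e j)"
  have "e ` {1..j} \<subseteq> e' ` {1..<j}"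
  proof clarify
    fix i assume i: "i \<in> {1..j}"
    have "e i \<in> exponent_tuples k"
      using e i by (auto simp: sorted_listing_def bij_betw_def)
    then obtain i' where i': "i' \<ge> 1" "e i = e' i'"
      using e' by (auto simp: sorted_listing_def bij_betw_def image_iff)
    have "?f (e i) \<le> ?f (e j)"
      using e i j by (auto simp: sorted_listing_def mono_on_def)
    then have "?f (e' i') < ?f (e' j)" using less i' by simp
    moreover have "?f (e' j) \<le> ?f (e' i')" if "j \<le> i'"
      using e' j i' that by (auto simp: sorted_listing_def mono_on_def)
    ultimately have "i' < j" by (meson not_le)
    then show "e i \<in> e' ` {1..<j}" using i' by auto
  qed
  then have "card (e ` {1..j}) \<le> card (e' ` {1..<j})" by (intro card_mono) auto
  also have "\<dots> \<le> card {1..<j}" by (rule card_image_le) simp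
  also have "card (e ` {1..j}) = card {1..j}"
  proof (rule card_image)
    have "inj_on e {1..}" using e by (simp add: sorted_listing_def bij_betw_def)
    then show "inj_on e {1..j}" by (rule inj_on_subset) auto
  qed
  finally show False using j by simp
qed

lemma ex1_sorted_listing_value:
  assumes "\<And>i. i \<in> {3..k} \<Longrightarrow> p i \<ge> 2" and "k \<ge> 3" and "j \<ge> 1"
  shows "\<exists>!x. \<exists>e. sorted_listing p k e \<and> x = power_product p k (e j)"
proof -
  obtain e where e: "sorted_listing p k e"
    using ex_sorted_listing[of k p] assms by blast
  show ?thesis
  proof (rule ex1I[of _ "power_product p k (e j)"])
    show "\<exists>e'. sorted_listing p k e' \<and> power_product p k (e j) = power_product p k (e' j)"
      using e by blast
    show "x = power_product p k (e j)"
      if "\<exists>e'. sorted_listing p k e' \<and> x = power_product p k (e' j)" for x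
      using that e sorted_listing_value_le \<open>j \<ge> 1\<close> by (metis order_antisym)
  qed
qed

end

theory Submission
  imports Defs
begin

text \<open>
  Both sides are governed by the least sum of power products over sets of \<open>n\<close> exponent tuples.
  This is also meaningful when some base equals 1, so that case needs no separate recursion.
  Splitting a set of tuples according to whether the last exponent vanishes gives the recursion of
  the generalized Frame--Stewart numbers, with \<open>t\<close> the number of tuples whose last exponent is 0.
  An optimal set may be assumed to contain the zero tuple, which accounts for the
  restriction \<open>t \<ge> 1\<close>.
\<close>

section \<open>Least sums over sets of given size, and sorted listings\<close>

definition least_sum :: "('a \<Rightarrow> nat) \<Rightarrow> 'a set \<Rightarrow> nat \<Rightarrow> nat" where
  "least_sum f E n = (LEAST s. \<exists>A\<subseteq>E. finite A \<and> card A = n \<and> sum f A = s)"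

lemma least_sum_le:
  assumes "A \<subseteq> E" "finite A" "card A = n"
  shows "least_sum f E n \<le> sum f A"
  unfolding least_sum_def using assms by (intro Least_le) blast

text \<open>An infinite \<open>E\<close> has subsets of every finite size, so the
  \<open>LEAST\<close> ranges over a nonempty set of values. If \<open>E\<close> had fewer than
  \<open>n\<close> elements, \<open>least_sum\<close> would be unspecified.\<close>

lemma least_sum_attained:
  assumes "infinite E"
  obtains A where "A \<subseteq> E" "finite A" "card A = n" "sum f A = least_sum f E n"
proof -
  obtain B where "finite B" "card B = n" "B \<subseteq> E"
    using infinite_arbitrarily_large[OF assms] by blast
  then have "\<exists>s. \<exists>A\<subseteq>E. finite A \<and> card A = n \<and> sum f A = s" by blast
  from LeastI_ex[OF this] show thesis
    using that unfolding least_sum_def by blast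
qed

text \<open>Exchange argument: if an optimal set misses the minimiser \<open>z\<close>, swapping any
  of its elements for \<open>z\<close> keeps the size and does not raise the sum.\<close>

lemma least_sum_attained_containing:
  assumes E: "infinite E" and z: "z \<in> E" "\<And>a. a \<in> E \<Longrightarrow> f z \<le> f a" and n: "n \<ge> 1"
  obtains A where "A \<subseteq> E" "finite A" "card A = n" "sum f A = least_sum f E n" "z \<in> A"
proof -
  obtain A where A: "A \<subseteq> E" "finite A" "card A = n" "sum f A = least_sum f E n"
    using least_sum_attained[OF E] by blast
  show thesis
  proof (cases "z \<in> A")
    case True
    then show thesis using that A by blast
  next
    case False
    obtain a where a: "a \<in> A" using A n by fastforce
    let ?B = "insert z (A - {a})"
    have B: "?B \<subseteq> E" "finite ?B" "card ?B = n"
      using A z a False n by (auto simp: card_Diff_singleton)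
    have "sum f ?B = f z + sum f (A - {a})" using A False by simp
    also have "\<dots> \<le> f a + sum f (A - {a})" using z(2)[of a] a A by auto
    also have "\<dots> = sum f A" using A a by (simp add: sum.remove)
    finally have "sum f ?B = least_sum f E n"
      using least_sum_le[OF B, of f] A by simp
    then show thesis using that B by blast
  qed
qed

text \<open>The sets \<open>?N - B\<close> and \<open>B - ?N\<close> have equal size, and
  \<open>g n\<close> separates them: by monotonicity \<open>g\<close> is at most \<open>g n\<close>
  on the first and at least \<open>g n\<close> on the second. The common part contributes equally to
  both sums.\<close>

lemma sum_initial_segment_le:
  fixes g :: "nat \<Rightarrow> nat"
  assumes g: "mono_on {1..} g" and B: "finite B" "B \<subseteq> {1..}" "card B = n"
  shows "sum g {1..n} \<le> sum g B"
proof -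
  let ?N = "{1..n}"
  have card: "card (?N - B) = card (B - ?N)"
    using B by (simp add: card_Diff_subset_Int Int_commute)
  have "sum g (?N - B) \<le> card (?N - B) * g n"
    using sum_bounded_above[of "?N - B" g "g n"] g by (auto simp: mono_on_def)
  also have "\<dots> \<le> sum g (B - ?N)"
  \<comment> \<open>For \<open>n = 0\<close> the threshold \<open>g 0\<close> lies outside the range
    on which \<open>g\<close> is monotone, but then \<open>?N\<close> is empty and the left side is
    0.\<close>
  proof (cases "n = 0")
    case False
    have "g n \<le> g i" if "i \<in> B - ?N" for i
      using that False B by (intro mono_onD[OF g]) auto
    then show ?thesis
      unfolding card using sum_bounded_below[of "B - ?N" "g n" g] by simp
  qed (use B in simp)
  finally have "sum g (?N - B) + sum g (?N \<inter> B) \<le> sum g (B - ?N) + sum g (B \<inter> ?N)"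
    by (simp add: Int_commute)
  then show ?thesis
    using sum.Int_Diff[of ?N g B] sum.Int_Diff[of B g ?N] B by simp
qed

text \<open>Through the bijection \<open>e\<close>, choosing \<open>n\<close> elements of
  \<open>E\<close> means choosing \<open>n\<close> positions of the listing, and the first
  \<open>n\<close> positions are the cheapest choice.\<close>

lemma least_sum_sorted:
  assumes e: "bij_betw e {1..} E" and mono: "mono_on {1..} (\<lambda>j. f (e j))"
  shows "least_sum f E n = (\<Sum>j=1..n. f (e j))"
proof (rule antisym)
  have inj: "inj_on e {1..}" and img: "e ` {1..} = E"
    using e by (auto simp: bij_betw_def)
  have injn: "inj_on e {1..n}" using inj by (rule inj_on_subset) auto
  have "least_sum f E n \<le> sum f (e ` {1..n})"
    using img card_image[OF injn] by (intro least_sum_le) auto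
  then show "least_sum f E n \<le> (\<Sum>j=1..n. f (e j))"
    by (simp only: sum.reindex[OF injn] o_def)
  have "infinite E" using bij_betw_finite[OF e] infinite_Ici[of "1::nat"] by simp
  then obtain A where A: "A \<subseteq> E" "finite A" "card A = n" "sum f A = least_sum f E n"
    using least_sum_attained by blast
  obtain B where B: "B \<subseteq> {1..}" "inj_on e B" "A = e ` B"
    using A(1) img subset_image_inj[of A e "{1..}"] by auto
  have "(\<Sum>j=1..n. f (e j)) \<le> (\<Sum>j\<in>B. f (e j))"
    using A B by (intro sum_initial_segment_le mono) (auto simp: finite_image_iff card_image)
  also have "\<dots> = sum f A" using B by (simp add: sum.reindex o_def)
  finally show "(\<Sum>j=1..n. f (e j)) \<le> least_sum f E n" using A by simp
qed

subsection \<open>Splitting by the last exponent\<close>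

lemma power_product_ge_1:
  assumes "\<And>i. i \<in> {3..k} \<Longrightarrow> p i > 0"
  shows "power_product p k \<alpha> \<ge> 1"
proof -
  have "0 < power_product p k \<alpha>"
    unfolding power_product_def using assms by (intro prod_pos) auto
  then show ?thesis by simp
qed

lemma exponent_tuples_split:
  assumes "k \<ge> 3"
  shows "exponent_tuples k = (\<lambda>\<alpha>. \<alpha>(k := 0)) ` exponent_tuples (k - 1)
           \<union> (\<lambda>\<alpha>. \<alpha>(k := Suc (\<alpha> k))) ` exponent_tuples k" (is "?E = ?L \<union> ?R")
proof (intro equalityI subsetI)
  fix \<alpha> assume \<alpha>: "\<alpha> \<in> ?E"
  show "\<alpha> \<in> ?L \<union> ?R"
  proof (cases "\<alpha> k")
    case 0
    \<comment> \<open>Tuples are extensional functions, so a tuple for \<open>k - 1\<close> must be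
      \<open>undefined\<close> at \<open>k\<close>.\<close>
    have "\<alpha>(k := undefined) \<in> exponent_tuples (k - 1)"
      unfolding exponent_tuples_def
    proof (rule PiE_I)
      fix i assume "i \<notin> {3..k - 1}"
      then have "i = k \<or> i \<notin> {3..k}" by auto
      then show "(\<alpha>(k := undefined)) i = undefined"
        using PiE_arb[OF \<alpha>[unfolded exponent_tuples_def]] by auto
    qed simp
    moreover have "\<alpha> = (\<alpha>(k := undefined))(k := 0)" using 0 by (simp add: fun_upd_idem)
    ultimately show ?thesis by (intro UnI1 image_eqI)
  next
    case (Suc m)
    have "\<alpha>(k := m) \<in> ?E"
      using \<alpha> assms by (auto simp: exponent_tuples_def PiE_iff extensional_def)
    moreover have "\<alpha> = (\<alpha>(k := m))(k := Suc ((\<alpha>(k := m)) k))"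
      using Suc by (simp add: fun_upd_idem)
    ultimately show ?thesis by (intro UnI2 image_eqI)
  qed
next
  fix \<alpha> assume "\<alpha> \<in> ?L \<union> ?R"
  then show "\<alpha> \<in> ?E"
    using assms by (auto simp: exponent_tuples_def PiE_iff extensional_def)
qed

text \<open>Overwriting position \<open>k\<close> loses no information, since all tuples for
  \<open>k - 1\<close> share the value \<open>undefined\<close> there.\<close>

lemma inj_on_append_zero:
  assumes "k \<ge> 3"
  shows "inj_on (\<lambda>\<alpha>. \<alpha>(k := 0)) (exponent_tuples (k - 1))"
proof (rule inj_onI)
  fix \<alpha> \<beta> assume *: "\<alpha> \<in> exponent_tuples (k - 1)" "\<beta> \<in> exponent_tuples (k - 1)"
    and eq: "\<alpha>(k := 0) = \<beta>(k := 0)"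
  have "\<alpha> k = \<beta> k"
    using * assms by (auto simp: exponent_tuples_def PiE_iff extensional_def)
  then show "\<alpha> = \<beta>" using eq by (metis fun_upd_triv fun_upd_upd)
qed

lemma inj_increment: "inj (\<lambda>\<alpha>. \<alpha>(k := Suc (\<alpha> k)))"
proof (rule injI)
  fix \<alpha> \<beta> :: "'a \<Rightarrow> nat" assume eq: "\<alpha>(k := Suc (\<alpha> k)) = \<beta>(k := Suc (\<beta> k))"
  then have "\<alpha> k = \<beta> k" by (metis fun_upd_same nat.inject)
  then show "\<alpha> = \<beta>" using eq by (metis fun_upd_triv fun_upd_upd)
qed

lemma power_product_last:
  assumes "k \<ge> 3"
  shows "power_product p k \<alpha> = power_product p (k - 1) \<alpha> * p k ^ \<alpha> k"
proof -
  have "{3..k} = insert k {3..k - 1}" using assms by auto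
  then show ?thesis using assms by (simp add: power_product_def mult.commute)
qed

lemma power_product_upd_last: "k \<ge> 3 \<Longrightarrow> power_product p (k - 1) (\<alpha>(k := a)) = power_product p (k - 1) \<alpha>"
  unfolding power_product_def by (rule prod.cong) auto

lemma power_product_append_zero:
  "k \<ge> 3 \<Longrightarrow> power_product p k (\<alpha>(k := 0)) = power_product p (k - 1) \<alpha>"
  by (simp add: power_product_last power_product_upd_last del: One_nat_def)

lemma power_product_increment:
  "k \<ge> 3 \<Longrightarrow> power_product p k (\<alpha>(k := Suc (\<alpha> k))) = p k * power_product p k \<alpha>"
  by (simp add: power_product_last power_product_upd_last del: One_nat_def)

text \<open>The two images are disjoint, having last exponent zero and positive respectively, and
  both maps are injective, so sizes and sums add up. Appending a zero preserves the power product;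
  incrementing the last exponent multiplies it by \<open>p k\<close>.\<close>

lemma join_tuple_sets:
  assumes k: "k \<ge> 3"
    and B: "B \<subseteq> exponent_tuples (k - 1)" "finite B" and C: "C \<subseteq> exponent_tuples k" "finite C"
  defines "A \<equiv> (\<lambda>\<alpha>. \<alpha>(k := 0)) ` B \<union> (\<lambda>\<alpha>. \<alpha>(k := Suc (\<alpha> k))) ` C"
  shows "A \<subseteq> exponent_tuples k" "finite A" "card A = card B + card C"
    "sum (power_product p k) A = sum (power_product p (k - 1)) B + p k * sum (power_product p k) C"
proof -
  let ?z = "\<lambda>\<alpha>::nat \<Rightarrow> nat. \<alpha>(k := 0)" and ?s = "\<lambda>\<alpha>::nat \<Rightarrow> nat. \<alpha>(k := Suc (\<alpha> k))"
  have z: "inj_on ?z B" by (rule inj_on_subset[OF inj_on_append_zero[OF k] B(1)])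
  have s: "inj_on ?s C" by (rule inj_on_subset[OF inj_increment]) simp
  have disj: "?z ` B \<inter> ?s ` C = {}" by (auto dest: fun_cong[of _ _ k])
  show "A \<subseteq> exponent_tuples k"
    unfolding A_def by (subst exponent_tuples_split[OF k]) (intro Un_mono image_mono B C)
  show "finite A" using B C by (simp add: A_def)
  show "card A = card B + card C"
    unfolding A_def using B C by (simp add: card_Un_disjoint disj card_image z s)
  show "sum (power_product p k) A
      = sum (power_product p (k - 1)) B + p k * sum (power_product p k) C"
    unfolding A_def using B C k
    by (simp add: sum.union_disjoint disj sum.reindex z s o_def sum_distrib_left
        power_product_append_zero power_product_increment)
qed

text \<open>Converse of \<open>join_tuple_sets\<close>: together they replace the choice of
  \<open>A\<close> by independent choices of \<open>B\<close> and \<open>C\<close>.\<close>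

lemma split_tuple_set:
  assumes k: "k \<ge> 3" and A: "A \<subseteq> exponent_tuples k" "finite A"
  obtains B C where "B \<subseteq> exponent_tuples (k - 1)" "finite B" "C \<subseteq> exponent_tuples k" "finite C"
    "A = (\<lambda>\<alpha>. \<alpha>(k := 0)) ` B \<union> (\<lambda>\<alpha>. \<alpha>(k := Suc (\<alpha> k))) ` C"
proof -
  let ?z = "\<lambda>\<alpha>::nat \<Rightarrow> nat. \<alpha>(k := 0)" and ?s = "\<lambda>\<alpha>::nat \<Rightarrow> nat. \<alpha>(k := Suc (\<alpha> k))"
  have "A \<subseteq> ?z ` exponent_tuples (k - 1) \<union> ?s ` exponent_tuples k"
    using A(1) exponent_tuples_split[OF k] by simp
  then obtain X Y where XY: "A = X \<union> Y"
    "X \<subseteq> ?z ` exponent_tuples (k - 1)" "Y \<subseteq> ?s ` exponent_tuples k"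
    by (rule subset_UnE)
  obtain B where "B \<subseteq> exponent_tuples (k - 1)" "finite B" "X = ?z ` B"
    using finite_subset_image[OF _ XY(2)] XY(1) A(2) by auto
  moreover obtain C where "C \<subseteq> exponent_tuples k" "finite C" "Y = ?s ` C"
    using finite_subset_image[OF _ XY(3)] XY(1) A(2) by auto
  ultimately show thesis using that XY(1) by blast
qed

subsection \<open>The recursion\<close>

abbreviation usum :: "(nat \<Rightarrow> nat) \<Rightarrow> nat \<Rightarrow> nat \<Rightarrow> nat" where
  "usum p k \<equiv> least_sum (power_product p k) (exponent_tuples k)"

lemma optimal_split:
  assumes p: "\<And>i. i \<ge> 3 \<Longrightarrow> p i > 0" and k: "k \<ge> 3" and n: "n \<ge> 1"
  obtains B C where "B \<subseteq> exponent_tuples (k - 1)" "finite B" "B \<noteq> {}"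
    "C \<subseteq> exponent_tuples k" "finite C" "card B + card C = n"
    "usum p k n = sum (power_product p (k - 1)) B + p k * sum (power_product p k) C"
proof -
  let ?o = "\<lambda>i\<in>{3..k}. 0::nat"
  have o: "?o \<in> exponent_tuples k" by (auto simp: exponent_tuples_def)
  have "power_product p k ?o = 1" by (simp add: power_product_def)
  \<comment> \<open>All bases are positive, so every power product is at least 1, the value at the
    zero tuple.\<close>
  then have min: "power_product p k ?o \<le> power_product p k \<alpha>" for \<alpha>
    using power_product_ge_1[of k p \<alpha>] p by simp
  obtain A where A: "A \<subseteq> exponent_tuples k" "finite A" "card A = n"
    "sum (power_product p k) A = usum p k n" "?o \<in> A"
    using least_sum_attained_containing[of _ _ "power_product p k", OF infinite_exponent_tuples[OF k] o min n] .
  obtain B C where BC: "B \<subseteq> exponent_tuples (k - 1)" "finite B" "C \<subseteq> exponent_tuples k" "finite C"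
    and A_eq: "A = (\<lambda>\<alpha>. \<alpha>(k := 0)) ` B \<union> (\<lambda>\<alpha>. \<alpha>(k := Suc (\<alpha> k))) ` C"
    using split_tuple_set[OF k A(1,2)] .
  \<comment> \<open>The zero tuple in \<open>A\<close> cannot come from \<open>C\<close>, whose
    image has positive last exponents.\<close>
  have "B \<noteq> {}"
    using A(5) k unfolding A_eq by (auto dest: fun_cong[of _ _ k])
  then show thesis
    using that[of B C] BC A(3,4) join_tuple_sets(3,4)[OF k BC] unfolding A_eq by simp
qed

text \<open>For \<open>k = 3\<close> the tuples without the last exponent form a singleton with
  empty product 1. The nonempty part \<open>B\<close> is therefore the whole singleton, which
  contributes the summand 1 and leaves \<open>n - 1\<close> tuples for \<open>C\<close>.\<close>

lemma usum_3:
  assumes p: "\<And>i. i \<ge> 3 \<Longrightarrow> p i > 0" and n: "n \<ge> 1"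
  shows "usum p 3 n = p 3 * usum p 3 (n - 1) + 1"
proof (rule antisym)
  have E2: "exponent_tuples 2 = {\<lambda>_. undefined}" by (simp add: exponent_tuples_def)
  have f2: "power_product p 2 \<alpha> = 1" for \<alpha> by (simp add: power_product_def)
  have inf: "infinite (exponent_tuples 3)" by (rule infinite_exponent_tuples) simp
  obtain C where C: "C \<subseteq> exponent_tuples 3" "finite C" "card C = n - 1"
    "sum (power_product p 3) C = usum p 3 (n - 1)"
    using least_sum_attained[OF inf] .
  have B: "exponent_tuples 2 \<subseteq> exponent_tuples (3 - 1)" "finite (exponent_tuples 2)"
    by (simp_all add: E2)
  note J = join_tuple_sets[OF order_refl B C(1,2)]
  show "usum p 3 n \<le> p 3 * usum p 3 (n - 1) + 1"
    using least_sum_le[OF J(1) J(2), of n "power_product p 3"] J(3) J(4)[of p] C n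
    by (simp add: E2 f2)
  obtain B C where BC: "B \<subseteq> exponent_tuples (3 - 1)" "finite B" "B \<noteq> {}"
    "C \<subseteq> exponent_tuples 3" "finite C" "card B + card C = n"
    "usum p 3 n = sum (power_product p (3 - 1)) B + p 3 * sum (power_product p 3) C"
    using optimal_split[of p 3 n] p n by blast
  have "B = exponent_tuples 2" using BC(1,3) E2 by (simp add: subset_singleton_iff)
  then have "card C = n - 1" "usum p 3 n = 1 + p 3 * sum (power_product p 3) C"
    using BC(6,7) by (simp_all add: E2 f2)
  then show "p 3 * usum p 3 (n - 1) + 1 \<le> usum p 3 n"
    using least_sum_le[OF BC(4,5)] by simp
qed

text \<open>Joining optimal sets of sizes \<open>t\<close> and \<open>n - t\<close> gives a
  competitor of size \<open>n\<close>.\<close>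

lemma usum_le:
  assumes k: "k \<ge> 4" and t: "t \<le> n"
  shows "usum p k n \<le> p k * usum p k (n - t) + usum p (k - 1) t"
proof -
  have inf: "infinite (exponent_tuples (k - 1))" "infinite (exponent_tuples k)"
    using k by (auto intro!: infinite_exponent_tuples)
  obtain B where B: "B \<subseteq> exponent_tuples (k - 1)" "finite B" "card B = t"
    "sum (power_product p (k - 1)) B = usum p (k - 1) t"
    using least_sum_attained[OF inf(1)] .
  obtain C where C: "C \<subseteq> exponent_tuples k" "finite C" "card C = n - t"
    "sum (power_product p k) C = usum p k (n - t)"
    using least_sum_attained[OF inf(2)] .
  have "k \<ge> 3" using k by simp
  note J = join_tuple_sets[OF this B(1,2) C(1,2)]
  show ?thesis
    using least_sum_le[OF J(1) J(2), of n "power_product p k"] J(3) J(4)[of p] B C t by simp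
qed

text \<open>The witness is \<open>t = card B\<close> for the split of an optimal set. Its parts cost
  at least the respective least sums, and \<open>usum_le\<close> gives the opposite
  inequality.\<close>

lemma usum_attained:
  assumes p: "\<And>i. i \<ge> 3 \<Longrightarrow> p i > 0" and k: "k \<ge> 4" and n: "n \<ge> 1"
  obtains t where "t \<in> {1..n}" "usum p k n = p k * usum p k (n - t) + usum p (k - 1) t"
proof -
  obtain B C where BC: "B \<subseteq> exponent_tuples (k - 1)" "finite B" "B \<noteq> {}"
    "C \<subseteq> exponent_tuples k" "finite C" "card B + card C = n"
    "usum p k n = sum (power_product p (k - 1)) B + p k * sum (power_product p k) C"
    using optimal_split[of p k n] p k n by auto
  have t: "card B \<in> {1..n}" using BC(2,3,6) card_gt_0_iff[of B] by simp
  have "usum p (k - 1) (card B) \<le> sum (power_product p (k - 1)) B"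
    using BC by (intro least_sum_le) auto
  moreover have "p k * usum p k (n - card B) \<le> p k * sum (power_product p k) C"
    using BC by (intro mult_le_mono2 least_sum_le) auto
  ultimately have "p k * usum p k (n - card B) + usum p (k - 1) (card B) \<le> usum p k n"
    unfolding BC(7) by linarith
  then have "usum p k n = p k * usum p k (n - card B) + usum p (k - 1) (card B)"
    using usum_le[OF k, of "card B" n p] t by simp
  with t show thesis using that by blast
qed

text \<open>The outer induction on \<open>k\<close> handles the term of index \<open>k - 1\<close>,
  the inner strong induction on \<open>n\<close> the term of the same index
  \<open>k\<close>.\<close>

lemma frame_stewart_eq_usum:
  assumes p: "\<And>i. i \<ge> 3 \<Longrightarrow> p i > 0" and k: "k \<ge> 3"
  shows "frame_stewart p q k n = (\<Prod>i=3..k. q i) * usum p k n"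
  using k
proof (induction k arbitrary: n rule: dec_induct)
  case base
  have "usum p 3 0 = 0"
    using least_sum_le[of "{}" _ 0] by fastforce
  then show ?case
    by (induction n) (auto simp: frame_stewart_0 frame_stewart_3 usum_3 p algebra_simps)
next
  case (step m)
  let ?k = "Suc m" and ?Q = "\<Prod>i=3..Suc m. q i"
  have k: "?k \<ge> 4" using step by simp
  have Q: "?Q = q ?k * (\<Prod>i=3..m. q i)"
    using step by (simp add: mult.commute)
  have zero: "usum p ?k 0 = 0"
    using least_sum_le[of "{}" _ 0] by fastforce
  show ?case
  proof (induction n rule: less_induct)
    case (less n)
    show ?case
    proof (cases "n = 0")
      case True
      then show ?thesis using zero by (simp add: frame_stewart_0)
    next
      case False
      let ?g = "\<lambda>t. p ?k * frame_stewart p q ?k (n - t) + q ?k * frame_stewart p q (?k - 1) t"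
      \<comment> \<open>Since \<open>t\<close> is at least 1, the inner hypothesis applies to
        \<open>n - t\<close> and already yields the factor \<open>?Q\<close>. In the other term,
        \<open>q ?k\<close> completes the product from the outer hypothesis to
        \<open>?Q\<close>.\<close>
      have g: "?g t = ?Q * (p ?k * usum p ?k (n - t) + usum p (?k - 1) t)" if "t \<in> {1..n}" for t
        using less[of "n - t"] step.IH[of t] that unfolding Q
        by (simp del: prod.cl_ivl_Suc add: Q algebra_simps)
      have "frame_stewart p q ?k n = Min (?g ` {1..n})"
        using k False by (subst frame_stewart.simps) auto
      also have "\<dots> = ?Q * usum p ?k n"
      \<comment> \<open>\<open>usum_le\<close> makes the value a lower bound, and
        \<open>usum_attained\<close> makes it one of the candidates.\<close>
      proof (rule Min_eqI)
        show "?Q * usum p ?k n \<le> y" if y: "y \<in> ?g ` {1..n}" for y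
        proof -
          obtain t where t: "t \<in> {1..n}" "y = ?g t" using y by blast
          show ?thesis unfolding t(2) g[OF t(1)]
            using usum_le[OF k, of t n p] t(1) by (intro mult_left_mono) auto
        qed
        obtain t where t: "t \<in> {1..n}"
          "usum p ?k n = p ?k * usum p ?k (n - t) + usum p (?k - 1) t"
          using usum_attained[of p ?k n] p k False by auto
        show "?Q * usum p ?k n \<in> ?g ` {1..n}"
          using g[OF t(1)] t by (intro image_eqI[of _ _ t]) auto
      qed simp
      finally show ?thesis .
    qed
  qed
qed

subsection \<open>The least sums as partial sums of the sorted sequence\<close>

text \<open>Varying only the exponent of the base 1 produces arbitrarily many distinct tuples of
  power product 1, and no power product is smaller. This matches the constant sequence fixed by
  convention.\<close>

lemma usum_base_1:
  assumes p: "\<And>i. i \<in> {3..k} \<Longrightarrow> p i > 0" and i: "i \<in> {3..k}" "p i = 1"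
  shows "usum p k n = n"
proof (rule antisym)
  let ?e = "\<lambda>a. \<lambda>j\<in>{3..k}. if j = i then a else (0::nat)"
  have inj: "inj_on ?e {..<n}"
    using i by (auto intro!: inj_onI dest!: fun_cong[of _ _ i])
  have "power_product p k (?e a) = 1" for a
    unfolding power_product_def using i by (intro prod.neutral) auto
  then have "sum (power_product p k) (?e ` {..<n}) = n"
    by (simp add: sum.reindex[OF inj])
  moreover have "usum p k n \<le> sum (power_product p k) (?e ` {..<n})"
    by (rule least_sum_le) (auto simp: exponent_tuples_def card_image[OF inj])
  ultimately show "usum p k n \<le> n" by simp
  have "infinite (exponent_tuples k)" using i by (intro infinite_exponent_tuples) simp
  then obtain A where A: "card A = n" "sum (power_product p k) A = usum p k n"
    using least_sum_attained by blast
  have "card A \<le> sum (power_product p k) A"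
    using sum_bounded_below[of A 1 "power_product p k"] power_product_ge_1[of k p] p by simp
  then show "n \<le> usum p k n" using A by simp
qed

lemma usum_eq_sum_useq:
  assumes p: "\<And>i. i \<in> {3..k} \<Longrightarrow> p i > 0" and k: "k \<ge> 3"
  shows "usum p k n = (\<Sum>j=1..n. useq p k j)"
proof (cases "\<exists>i\<in>{3..k}. p i = 1")
  case True
  then have "useq p k j = 1" for j by (simp add: useq_def)
  moreover have "usum p k n = n" using True usum_base_1 p by blast
  ultimately show ?thesis by simp
next
  case False
  \<comment> \<open>Bases of at least 2 ensure that a sorted listing exists and that its
    \<open>j\<close>-th value is unique, so that \<open>THE\<close> in \<open>useq\<close> denotes
    the value along \<open>e\<close>.\<close>
  have p2: "p i \<ge> 2" if "i \<in> {3..k}" for i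
    using False p[OF that] that by (metis One_nat_def Suc_1 Suc_leI le_neq_implies_less)
  obtain e where e: "sorted_listing p k e" using ex_sorted_listing[of k p] p2 k by blast
  have "useq p k j = power_product p k (e j)" if "j \<ge> 1" for j
  proof -
    have "useq p k j = (THE x. \<exists>e. sorted_listing p k e \<and> x = power_product p k (e j))"
      using False by (simp add: useq_def)
    also have "\<dots> = power_product p k (e j)"
      using ex1_sorted_listing_value[of k p j] p2 k that e by (intro the1_equality) auto
    finally show ?thesis .
  qed
  then show ?thesis
    using least_sum_sorted[of e "exponent_tuples k" "power_product p k" n] e
    by (simp add: sorted_listing_def)
qed

theorem theorem1:
  fixes p q :: "nat \<Rightarrow> nat" and k n :: nat
  assumes "\<And>i. i \<ge> 3 \<Longrightarrow> p i > 0"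
    and "\<And>i. i \<ge> 3 \<Longrightarrow> q i > 0"
    and "k \<ge> 3"
    and "n \<ge> 1"
  shows "frame_stewart p q k n = (\<Prod>i=3..k. q i) * (\<Sum>j=1..n. useq p k j)"
  using frame_stewart_eq_usum[of p k q n] usum_eq_sum_useq[of k p n] assms(1,3) by simp

end
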